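(* Let $L_n$ be the ladder graph with vertex set $V(L_n)=\{a_1,a_2,\ldots,a_n,b_1,b_2,\ldots,b_n\}$ and edge set $E(L_n)=\{a_1a_2,\ldots,a_{n-1}a_n,\, b_1b_2,\ldots,b_{n-1}b_n,\, a_1b_1,\ldots,a_nb_n\}$, i.e. the Cartesian product of the path graphs $P_n$ and $P_2$. Then $\gamma_{plsR}(L_n)=\left\lceil\frac{6n}{5}\right\rceil$.
   Context: All graphs are finite, without loops or parallel edges. For a graph $G=(V,E)$ and $v\in V$, $N[v]=\{v\}\cup\{u : uv\in E\}$ is the closed neighborhood. A perfect locating signed Roman dominating (PLSRD) function on $G=(V,E)$ is a function $f: V\to\{-1,1,2\}$ such that: (C1) each vertex $v$ with $f(v)=-1$ is adjacent to exactly one vertex $u$ with $f(u)=2$; (C2) distinct vertices $v,w$ with $f(v)=f(w)=-1$ have no common neighbor $u$ with $f(u)=2$; (C3) for every vertex $v$, $\sum_{u\in N[v]} f(u)\geq 1$. The weight of $f$ is $f(V)=\sum_{v\in V} f(v)$. The perfect locating signed Roman domination number $\gamma_{plsR}(G)$ is the minimum weight over all PLSRD functions on $G$.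
   Formalization: The formal statement assumes n ≥ 2, because the formula fails for n = 1: L_1 is a single edge, and labelling its ends −1 and 2 gives a PLSRD function of weight 1, whereas ⌈6/5⌉ = 2. *)

theory Defs
  imports Complex_Main "HOL-Library.FuncSet"
begin

(* A graph is a vertex set V with a set E of two-element subsets of V. *)

definition finite_simple_graph :: "'a set \<Rightarrow> 'a set set \<Rightarrow> bool" where
  "finite_simple_graph V E \<longleftrightarrow> finite V \<and> (\<forall>e\<in>E. e \<subseteq> V \<and> card e = 2)"

definition closed_nbhd :: "'a set \<Rightarrow> 'a set set \<Rightarrow> 'a \<Rightarrow> 'a set" where
  "closed_nbhd V E v = insert v {u \<in> V. {u, v} \<in> E}"

(* Values outside V are unconstrained; no clause below, nor the weight, depends on them. *)

definition plsrd_function :: "'a set \<Rightarrow> 'a set set \<Rightarrow> ('a \<Rightarrow> int) \<Rightarrow> bool" where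
  "plsrd_function V E f \<longleftrightarrow>
     f \<in> V \<rightarrow> {-1, 1, 2} \<and>
     (\<forall>v\<in>V. f v = -1 \<longrightarrow> (\<exists>!u. u \<in> V \<and> {u, v} \<in> E \<and> f u = 2)) \<and>
     (\<forall>v\<in>V. \<forall>w\<in>V. v \<noteq> w \<and> f v = -1 \<and> f w = -1 \<longrightarrow>
        \<not> (\<exists>u\<in>V. {u, v} \<in> E \<and> {u, w} \<in> E \<and> f u = 2)) \<and>
     (\<forall>v\<in>V. (\<Sum>u\<in>closed_nbhd V E v. f u) \<ge> 1)"

definition plsrd_weight :: "'a set \<Rightarrow> ('a \<Rightarrow> int) \<Rightarrow> int" where
  "plsrd_weight V f = (\<Sum>v\<in>V. f v)"

definition plsrd_number :: "'a set \<Rightarrow> 'a set set \<Rightarrow> int" where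
  "plsrd_number V E = Min {plsrd_weight V f |f. plsrd_function V E f}"

(* On a finite simple graph the minimum is taken over a finite nonempty set:
   the constant function 1 is always a PLSRD function. *)

lemma plsrd_weights_nonempty:
  assumes "finite_simple_graph V E"
  shows "{plsrd_weight V f |f. plsrd_function V E f} \<noteq> {}"
proof -
  have "plsrd_function V E (\<lambda>_. 1)"
    using assms
    by (auto simp: plsrd_function_def closed_nbhd_def finite_simple_graph_def card_insert_if)
  then show ?thesis by blast
qed

lemma plsrd_weights_finite:
  assumes "finite_simple_graph V E"
  shows "finite {plsrd_weight V f |f. plsrd_function V E f}"
proof (rule finite_subset)
  show "{plsrd_weight V f |f. plsrd_function V E f} \<subseteq> {- int (card V)..2 * int (card V)}"
  proof clarify
    fix f assume "plsrd_function V E f"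
    then have f: "f v \<in> {-1, 1, 2}" if "v \<in> V" for v
      using that unfolding plsrd_function_def by blast
    have "-1 \<le> f v" "f v \<le> 2" if "v \<in> V" for v
      using f[OF that] by auto
    then show "plsrd_weight V f \<in> {- int (card V)..2 * int (card V)}"
      using sum_bounded_below[of V "-1" f] sum_bounded_above[of V f 2]
      by (simp add: plsrd_weight_def mult.commute)
  qed
qed simp

datatype ladder_vertex = VA nat | VB nat

definition ladder_vertices :: "nat \<Rightarrow> ladder_vertex set" where
  "ladder_vertices n = VA ` {1..n} \<union> VB ` {1..n}"

definition ladder_edges :: "nat \<Rightarrow> ladder_vertex set set" where
  "ladder_edges n =
     {{VA i, VA (i + 1)} |i. 1 \<le> i \<and> i < n} \<union>
     {{VB i, VB (i + 1)} |i. 1 \<le> i \<and> i < n} \<union>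
     {{VA i, VB i} |i. 1 \<le> i \<and> i \<le> n}"

lemma finite_simple_graph_ladder:
  "finite_simple_graph (ladder_vertices n) (ladder_edges n)"
  by (auto simp: finite_simple_graph_def ladder_vertices_def ladder_edges_def)

end

theory Submission
  imports Defs
begin

text \<open>
  Lower bound. Let \<open>M\<close>, \<open>Q\<close>, \<open>P\<close> be the numbers of vertices with value \<open>-1\<close>, \<open>1\<close>, \<open>2\<close>.
  Conditions (C1) and (C2) give \<open>M \<le> P\<close>. If all degrees are \<open>2\<close> or \<open>3\<close>, then (C3) shows that
  every vertex of value \<open>-1\<close> has a neighbour of value \<open>1\<close> and that every vertex of value \<open>1\<close> has
  at most two neighbours of value \<open>-1\<close>, so \<open>M \<le> 2 Q\<close>. Hence
  \<open>5 (2 P + Q - M) - 3 (P + Q + M) = 7 P + 2 Q - 8 M \<ge> 0\<close>, which is \<open>5 f(V) \<ge> 3 |V|\<close>.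

  Upper bound. Start with explicit labellings of \<open>2, \<dots>, 6\<close> columns and repeatedly
  interchange the two rows and prepend the block
  \<open>(-1,2), (1,2), (-1,-1), (2,1), (2,-1)\<close> of weight \<open>6\<close>.
\<close>

section \<open>Graphs with degrees two and three\<close>

definition nbhd :: "'a set \<Rightarrow> 'a set set \<Rightarrow> 'a \<Rightarrow> 'a set" where
  "nbhd V E v = {u \<in> V. {u, v} \<in> E}"

lemma closed_nbhd_eq: "closed_nbhd V E v = insert v (nbhd V E v)"
  by (simp add: closed_nbhd_def nbhd_def)

lemma nbhd_sym: "u \<in> nbhd V E v \<Longrightarrow> v \<in> V \<Longrightarrow> v \<in> nbhd V E u"
  by (simp add: nbhd_def insert_commute)

lemma
  assumes "finite_simple_graph V E"
  shows finite_nbhd: "finite (nbhd V E v)"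
    and not_in_nbhd: "v \<notin> nbhd V E v"
  using assms by (auto simp: finite_simple_graph_def nbhd_def)

text \<open>(C2) is read from the side of a vertex of value 2, which may have at most one neighbour
  of value -1. (C3) splits off \<open>f v\<close> because there are no loops.\<close>

lemma plsrd_function_iff:
  assumes "finite_simple_graph V E"
  shows "plsrd_function V E f \<longleftrightarrow>
     (\<forall>v\<in>V. f v \<in> {-1, 1, 2}) \<and>
     (\<forall>v\<in>V. f v = -1 \<longrightarrow> (\<exists>!u. u \<in> nbhd V E v \<and> f u = 2)) \<and>
     (\<forall>u\<in>V. f u = 2 \<longrightarrow>
        (\<forall>v\<in>nbhd V E u. \<forall>w\<in>nbhd V E u. f v = -1 \<longrightarrow> f w = -1 \<longrightarrow> v = w)) \<and>
     (\<forall>v\<in>V. f v + (\<Sum>u\<in>nbhd V E v. f u) \<ge> 1)"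
proof -
  have edge: "{u, v} \<in> E \<longleftrightarrow> v \<in> nbhd V E u" if "v \<in> V" for u v
    using that by (simp add: nbhd_def insert_commute)
  have C1: "(\<exists>!u. u \<in> V \<and> {u, v} \<in> E \<and> f u = 2) \<longleftrightarrow> (\<exists>!u. u \<in> nbhd V E v \<and> f u = 2)" for v
    by (simp add: nbhd_def)
  have C2: "(\<forall>v\<in>V. \<forall>w\<in>V. v \<noteq> w \<and> f v = -1 \<and> f w = -1 \<longrightarrow>
        \<not> (\<exists>u\<in>V. {u, v} \<in> E \<and> {u, w} \<in> E \<and> f u = 2)) \<longleftrightarrow>
     (\<forall>u\<in>V. f u = 2 \<longrightarrow>
        (\<forall>v\<in>nbhd V E u. \<forall>w\<in>nbhd V E u. f v = -1 \<longrightarrow> f w = -1 \<longrightarrow> v = w))"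
    (is "?L \<longleftrightarrow> ?R")
  proof
    assume ?L
    moreover have "v \<in> V \<and> {u, v} \<in> E" if "v \<in> nbhd V E u" for u v
      using that by (simp add: nbhd_def insert_commute)
    ultimately show ?R by metis
  next
    assume ?R
    then show ?L using edge by blast
  qed
  have C3: "(\<Sum>u\<in>closed_nbhd V E v. f u) = f v + (\<Sum>u\<in>nbhd V E v. f u)" for v
    using finite_nbhd[OF assms] not_in_nbhd[OF assms] by (simp add: closed_nbhd_eq)
  show ?thesis
    unfolding plsrd_function_def C1 C2 C3 Pi_iff ..
qed

section \<open>Counting argument for the lower bound\<close>

text \<open>(C1) sends each vertex of value -1 to a neighbour of value 2, and (C2) makes this map
  injective.\<close>

lemma card_minus_one_le_card_two:
  assumes G: "finite_simple_graph V E" and f: "plsrd_function V E f"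
  shows "card {v \<in> V. f v = -1} \<le> card {v \<in> V. f v = 2}"
proof -
  note f' = f[unfolded plsrd_function_iff[OF G]]
  have "\<forall>v\<in>{v \<in> V. f v = -1}. \<exists>u. u \<in> nbhd V E v \<and> f u = 2"
    using f' by blast
  then obtain g where g: "\<And>v. v \<in> V \<Longrightarrow> f v = -1 \<Longrightarrow> g v \<in> nbhd V E v \<and> f (g v) = 2"
    by (metis (mono_tags, lifting) mem_Collect_eq)
  have gV: "g v \<in> V" if "v \<in> V" "f v = -1" for v
    using g[OF that] by (simp add: nbhd_def)
  show ?thesis
  proof (rule card_inj_on_le)
    show "inj_on g {v \<in> V. f v = -1}"
    proof (rule inj_onI)
      fix v w assume "v \<in> {v \<in> V. f v = -1}" "w \<in> {v \<in> V. f v = -1}" and eq: "g v = g w"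
      then have v: "v \<in> V" "f v = -1" and w: "w \<in> V" "f w = -1" by auto
      have "v \<in> nbhd V E (g v)" "w \<in> nbhd V E (g v)"
        using g[OF v] g[OF w] v w eq by (auto intro: nbhd_sym)
      then show "v = w" using f' gV[OF v] g[OF v] v w by blast
    qed
    show "g ` {v \<in> V. f v = -1} \<subseteq> {v \<in> V. f v = 2}" using g gV by auto
    show "finite {v \<in> V. f v = 2}" using G by (simp add: finite_simple_graph_def)
  qed
qed

text \<open>Otherwise (C1) leaves one neighbour of value 2 and at least one other, all others having
  value -1; the closed sum is then at most -1 + 2 - 1 = 0, against (C3).\<close>

lemma ex_one_neighbour:
  assumes G: "finite_simple_graph V E" and f: "plsrd_function V E f"
    and v: "v \<in> V" "f v = -1" and deg: "2 \<le> card (nbhd V E v)"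
  shows "\<exists>u\<in>nbhd V E v. f u = 1"
proof (rule ccontr)
  assume no: "\<not> ?thesis"
  note f' = f[unfolded plsrd_function_iff[OF G]]
  obtain u where u: "u \<in> nbhd V E v" "f u = 2"
    and uniq: "\<And>w. w \<in> nbhd V E v \<Longrightarrow> f w = 2 \<Longrightarrow> w = u"
    using f' v by blast
  have fin: "finite (nbhd V E v)" by (rule finite_nbhd[OF G])
  have "f w = -1" if "w \<in> nbhd V E v - {u}" for w
  proof -
    have "w \<in> V" using that by (simp add: nbhd_def)
    then have "f w \<in> {-1, 1, 2}" using f' by blast
    then show ?thesis using no uniq that by auto
  qed
  then have "(\<Sum>w\<in>nbhd V E v - {u}. f w) = - int (card (nbhd V E v - {u}))"
    by simp
  also have "\<dots> \<le> -1" using deg u fin by simp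
  finally have "(\<Sum>w\<in>nbhd V E v. f w) \<le> 1"
    using u by (simp add: sum.remove[OF fin u(1)])
  moreover have "f v + (\<Sum>w\<in>nbhd V E v. f w) \<ge> 1" using f' v by blast
  ultimately show False using v by simp
qed

text \<open>With k neighbours of value -1 the closed sum is at most 1 + 2 (3 - k) - k = 7 - 3 k, so
  (C3) excludes k = 3.\<close>

lemma card_minus_one_neighbours_le:
  assumes G: "finite_simple_graph V E" and f: "plsrd_function V E f"
    and u: "u \<in> V" "f u = 1" and deg: "card (nbhd V E u) \<le> 3"
  shows "card {v \<in> nbhd V E u. f v = -1} \<le> 2"
proof -
  note f' = f[unfolded plsrd_function_iff[OF G]]
  let ?N = "nbhd V E u"
  let ?K = "{v \<in> ?N. f v = -1}"
  have fin: "finite ?N" by (rule finite_nbhd[OF G])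
  have "f v \<le> 2" if "v \<in> ?N - ?K" for v
  proof -
    have "v \<in> V" using that by (simp add: nbhd_def)
    then have "f v \<in> {-1, 1, 2}" using f' by blast
    then show ?thesis by auto
  qed
  then have "sum f (?N - ?K) \<le> int (card (?N - ?K)) * 2"
    by (rule sum_bounded_above)
  moreover have "sum f ?N = sum f (?N - ?K) + sum f ?K"
    using fin by (intro sum.subset_diff) auto
  moreover have "sum f ?K = - int (card ?K)" by simp
  moreover have "card (?N - ?K) + card ?K = card ?N"
    using fin by (metis (no_types, lifting) card_Diff_subset card_mono finite_subset
        le_add_diff_inverse2 mem_Collect_eq subsetI)
  moreover have "f u + sum f ?N \<ge> 1" using f' u by blast
  ultimately show ?thesis using u deg by linarith
qed

text \<open>The neighbourhoods of the vertices of value 1 cover all vertices of value -1, and each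
  contains at most two of them.\<close>

lemma card_minus_one_le_twice_card_one:
  assumes G: "finite_simple_graph V E" and f: "plsrd_function V E f"
    and deg: "\<And>v. v \<in> V \<Longrightarrow> card (nbhd V E v) \<in> {2..3}"
  shows "card {v \<in> V. f v = -1} \<le> 2 * card {v \<in> V. f v = 1}"
proof -
  let ?Q = "{v \<in> V. f v = 1}"
  have fin: "finite V" using G by (simp add: finite_simple_graph_def)
  have "{v \<in> V. f v = -1} \<subseteq> (\<Union>u\<in>?Q. {v \<in> nbhd V E u. f v = -1})"
  proof
    fix v assume "v \<in> {v \<in> V. f v = -1}"
    then have v: "v \<in> V" "f v = -1" by auto
    then obtain u where u: "u \<in> nbhd V E v" "f u = 1"
      using ex_one_neighbour[OF G f v] deg by force
    then have "u \<in> V" by (simp add: nbhd_def)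
    then show "v \<in> (\<Union>u\<in>?Q. {v \<in> nbhd V E u. f v = -1})"
      using u v nbhd_sym[OF u(1) v(1)] by auto
  qed
  then have "card {v \<in> V. f v = -1} \<le> card (\<Union>u\<in>?Q. {v \<in> nbhd V E u. f v = -1})"
    using fin finite_nbhd[OF G] by (intro card_mono) auto
  also have "\<dots> \<le> (\<Sum>u\<in>?Q. card {v \<in> nbhd V E u. f v = -1})"
    using fin by (intro card_UN_le) auto
  also have "\<dots> \<le> card ?Q * 2"
  proof -
    have "card {v \<in> nbhd V E u. f v = -1} \<le> 2" if "u \<in> ?Q" for u
      using card_minus_one_neighbours_le[OF G f, of u] deg[of u] that by simp
    then show ?thesis
      using sum_bounded_above[of ?Q "\<lambda>u. card {v \<in> nbhd V E u. f v = -1}" 2] by simp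
  qed
  finally show ?thesis by simp
qed

theorem plsrd_weight_ge:
  assumes G: "finite_simple_graph V E" and f: "plsrd_function V E f"
    and deg: "\<And>v. v \<in> V \<Longrightarrow> card (nbhd V E v) \<in> {2..3}"
  shows "3 * int (card V) \<le> 5 * plsrd_weight V f"
proof -
  let ?S = "\<lambda>c. {v \<in> V. f v = c}"
  have fin: "finite V" using G by (simp add: finite_simple_graph_def)
  have V: "V = ?S (-1) \<union> (?S 1 \<union> ?S 2)"
    using f by (auto simp: plsrd_function_iff[OF G])
  have sums: "sum g V = sum g (?S (-1)) + (sum g (?S 1) + sum g (?S 2))" for g :: "'a \<Rightarrow> int"
  proof -
    have "sum g (?S 1 \<union> ?S 2) = sum g (?S 1) + sum g (?S 2)"
      using fin by (intro sum.union_disjoint) auto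
    moreover have "sum g (?S (-1) \<union> (?S 1 \<union> ?S 2)) = sum g (?S (-1)) + sum g (?S 1 \<union> ?S 2)"
      using fin by (intro sum.union_disjoint) auto
    ultimately show ?thesis using V by simp
  qed
  have "int (card V) = int (card (?S (-1))) + (int (card (?S 1)) + int (card (?S 2)))"
    using sums[of "\<lambda>_. 1"] by simp
  moreover have "plsrd_weight V f
      = - int (card (?S (-1))) + (int (card (?S 1)) + 2 * int (card (?S 2)))"
    using sums[of f] by (simp add: plsrd_weight_def)
  \<comment> \<open>In the notation of the overview, the difference of the two sides is 7 (P - M) +
    (2 Q - M).\<close>
  ultimately show ?thesis
    using card_minus_one_le_card_two[OF G f] card_minus_one_le_twice_card_one[OF G f deg]
    by linarith
qed

section \<open>Neighbourhoods in the ladder\<close>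

lemma in_ladder_vertices [simp]:
  "VA i \<in> ladder_vertices n \<longleftrightarrow> i \<in> {1..n}"
  "VB i \<in> ladder_vertices n \<longleftrightarrow> i \<in> {1..n}"
  by (auto simp: ladder_vertices_def)

lemma VA_in_nbhd_ladder:
  "VA j \<in> nbhd (ladder_vertices n) (ladder_edges n) v \<longleftrightarrow> j \<in> {1..n} \<and>
     (case v of VA i \<Rightarrow> i \<in> {1..n} \<and> (j = i + 1 \<or> i = j + 1) | VB i \<Rightarrow> i = j)"
  by (cases v) (auto simp: nbhd_def ladder_vertices_def ladder_edges_def doubleton_eq_iff)

lemma VB_in_nbhd_ladder:
  "VB j \<in> nbhd (ladder_vertices n) (ladder_edges n) v \<longleftrightarrow> j \<in> {1..n} \<and>
     (case v of VB i \<Rightarrow> i \<in> {1..n} \<and> (j = i + 1 \<or> i = j + 1) | VA i \<Rightarrow> i = j)"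
  by (cases v) (auto simp: nbhd_def ladder_vertices_def ladder_edges_def doubleton_eq_iff)

text \<open>Intersecting with the vertex set discards columns 0 and n + 1, so one formula also
  covers the end columns.\<close>

lemma nbhd_ladder_VA:
  assumes "i \<in> {1..n}"
  shows "nbhd (ladder_vertices n) (ladder_edges n) (VA i) =
     {VA (i - 1), VA (i + 1), VB i} \<inter> ladder_vertices n" (is "?N = ?R")
proof (rule set_eqI)
  fix u show "u \<in> ?N \<longleftrightarrow> u \<in> ?R"
    using assms
    by (cases u) (auto simp: VA_in_nbhd_ladder VB_in_nbhd_ladder)
qed

lemma nbhd_ladder_VB:
  assumes "i \<in> {1..n}"
  shows "nbhd (ladder_vertices n) (ladder_edges n) (VB i) =
     {VB (i - 1), VB (i + 1), VA i} \<inter> ladder_vertices n" (is "?N = ?R")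
proof (rule set_eqI)
  fix u show "u \<in> ?N \<longleftrightarrow> u \<in> ?R"
    using assms
    by (cases u) (auto simp: VA_in_nbhd_ladder VB_in_nbhd_ladder)
qed

lemma card_nbhd_ladder:
  assumes n: "2 \<le> n" and v: "v \<in> ladder_vertices n"
  shows "card (nbhd (ladder_vertices n) (ladder_edges n) v) \<in> {2..3}"
proof -
  let ?N = "nbhd (ladder_vertices n) (ladder_edges n) v"
  have fin: "finite ?N" by (rule finite_nbhd[OF finite_simple_graph_ladder])
  \<comment> \<open>Two sure neighbours are the partner on the rung and one vertex in the same row:
    the right one in column 1, the left one elsewhere. The third candidate may be missing.\<close>
  have "\<exists>x y z. x \<noteq> y \<and> {x, y} \<subseteq> ?N \<and> ?N \<subseteq> {x, y, z}"
  proof (cases v)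
    case (VA i)
    then have i: "i \<in> {1..n}" using v by simp
    show ?thesis unfolding VA nbhd_ladder_VA[OF i]
      by (cases "i = 1", rule exI[of _ "VA (i + 1)"], rule_tac [2] exI[of _ "VA (i - 1)"];
          rule exI[of _ "VB i"])
        (use i n in auto)
  next
    case (VB i)
    then have i: "i \<in> {1..n}" using v by simp
    show ?thesis unfolding VB nbhd_ladder_VB[OF i]
      by (cases "i = 1", rule exI[of _ "VB (i + 1)"], rule_tac [2] exI[of _ "VB (i - 1)"];
          rule exI[of _ "VA i"])
        (use i n in auto)
  qed
  then obtain x y z where "x \<noteq> y" and sub: "{x, y} \<subseteq> ?N" "?N \<subseteq> {x, y, z}" by blast
  have "card {x, y} \<le> card ?N" using sub fin by (intro card_mono)
  moreover have "card ?N \<le> card {x, y, z}" using sub by (intro card_mono) auto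
  moreover have "card {x, y, z} \<le> 3" by (simp add: card_insert_if)
  ultimately show ?thesis using \<open>x \<noteq> y\<close> by simp
qed

lemma sum_ladder_vertices:
  "(\<Sum>v\<in>ladder_vertices n. f v) = (\<Sum>i=1..n. f (VA i) + f (VB i))"
  unfolding ladder_vertices_def
  by (subst sum.union_disjoint) (auto simp: sum.reindex inj_on_def sum.distrib)

lemma card_ladder_vertices: "card (ladder_vertices n) = 2 * n"
  using sum_ladder_vertices[of "\<lambda>_. 1 :: nat" n] by simp

section \<open>Labellings of the ladder as lists of columns\<close>

text \<open>The conditions at one vertex, in a form that simplification can evaluate.
  \<open>ys\<close> lists the neighbouring values, with 0 for a missing neighbour: it affects
  neither the sum nor the counts of 2 and -1.\<close>

definition vertex_ok :: "int \<Rightarrow> int list \<Rightarrow> bool" where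
  "vertex_ok x ys \<longleftrightarrow> x \<in> {-1, 1, 2} \<and> x + sum_list ys \<ge> 1 \<and>
     (x = -1 \<longrightarrow> length (filter (\<lambda>y. y = 2) ys) = 1) \<and>
     (x = 2 \<longrightarrow> length (filter (\<lambda>y. y = -1) ys) \<le> 1)"

fun column_ok :: "int \<times> int \<Rightarrow> int \<times> int \<Rightarrow> int \<times> int \<Rightarrow> bool" where
  "column_ok (a, b) (c, d) (e, g) \<longleftrightarrow> vertex_ok c [a, e, d] \<and> vertex_ok d [b, g, c]"

text \<open>The first and last columns are never tested themselves; they only supply context, such
  as padding.\<close>

fun columns_ok :: "(int \<times> int) list \<Rightarrow> bool" where
  "columns_ok (p # q # r # xs) \<longleftrightarrow> column_ok p q r \<and> columns_ok (q # r # xs)"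
| "columns_ok _ \<longleftrightarrow> True"

lemma columns_ok_nth:
  "columns_ok xs \<Longrightarrow> i + 2 < length xs \<Longrightarrow> column_ok (xs ! i) (xs ! (i + 1)) (xs ! (i + 2))"
proof (induction xs arbitrary: i rule: columns_ok.induct)
  case (1 p q r xs)
  then show ?case by (cases i) auto
qed auto

lemma column_ok_swap:
  "column_ok (prod.swap p) (prod.swap q) (prod.swap r) \<longleftrightarrow> column_ok p q r"
  by (cases p; cases q; cases r) auto

lemma columns_ok_swap: "columns_ok (map prod.swap xs) \<longleftrightarrow> columns_ok xs"
  by (induction xs rule: columns_ok.induct) (auto simp: column_ok_swap)

definition weight :: "(int \<times> int) list \<Rightarrow> int" where
  "weight xs = (\<Sum>x\<leftarrow>xs. fst x + snd x)"

lemma weight_swap: "weight (map prod.swap xs) = weight xs"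
  by (simp add: weight_def o_def add.commute)

text \<open>Column \<open>i\<close> of the ladder is entry \<open>i\<close> of a list that is padded with zero columns at both ends.\<close>

definition labelling :: "(int \<times> int) list \<Rightarrow> ladder_vertex \<Rightarrow> int" where
  "labelling xs v = (case v of VA i \<Rightarrow> fst (xs ! i) | VB i \<Rightarrow> snd (xs ! i))"

lemma vertex_ok_neighbours:
  fixes f :: "'a \<Rightarrow> int"
  assumes ok: "vertex_ok (f v) [f x, f y, f z]" and dist: "distinct [x, y, z]"
    and N: "N = {x, y, z} \<inter> V" and zero: "\<And>u. u \<in> {x, y, z} - V \<Longrightarrow> f u = 0"
  shows "f v \<in> {-1, 1, 2}"
    and "f v = -1 \<Longrightarrow> \<exists>!u. u \<in> N \<and> f u = 2"
    and "f v = 2 \<Longrightarrow> \<forall>p\<in>N. \<forall>q\<in>N. f p = -1 \<longrightarrow> f q = -1 \<longrightarrow> p = q"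
    and "f v + sum f N \<ge> 1"
proof -
  show "f v \<in> {-1, 1, 2}" using ok by (simp add: vertex_ok_def)
  \<comment> \<open>A vertex of value 2 or -1 cannot be one of the absent neighbours, which all have
    value 0.\<close>
  have N': "u \<in> N \<longleftrightarrow> u \<in> {x, y, z}" if "f u \<noteq> 0" for u
    using N zero that by auto
  have "\<exists>!u. u \<in> {x, y, z} \<and> f u = 2" if "f v = -1"
    using ok dist that by (auto simp: vertex_ok_def split: if_splits)
  then show "\<exists>!u. u \<in> N \<and> f u = 2" if "f v = -1"
    using that N' by (metis zero_neq_numeral)
  show "\<forall>p\<in>N. \<forall>q\<in>N. f p = -1 \<longrightarrow> f q = -1 \<longrightarrow> p = q" if "f v = 2"
    using ok that N by (auto simp: vertex_ok_def split: if_splits)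
  have "sum f N = sum f {x, y, z}"
    using N zero by (intro sum.mono_neutral_left) auto
  then show "f v + sum f N \<ge> 1" using ok dist by (simp add: vertex_ok_def algebra_simps)
qed

lemma plsrd_function_labelling:
  assumes ok: "columns_ok ((0, 0) # xs @ [(0, 0)])" and n: "length xs = n"
  defines "f \<equiv> labelling ((0, 0) # xs @ [(0, 0)])"
  shows "plsrd_function (ladder_vertices n) (ladder_edges n) f"
proof -
  let ?V = "ladder_vertices n" and ?E = "ladder_edges n"
  have zero: "f (VA 0) = 0" "f (VB 0) = 0" "f (VA (n + 1)) = 0" "f (VB (n + 1)) = 0"
    using n by (auto simp: f_def labelling_def nth_append)
  have "\<exists>x y z. vertex_ok (f v) [f x, f y, f z] \<and> distinct [x, y, z] \<and>
      nbhd ?V ?E v = {x, y, z} \<inter> ?V \<and> (\<forall>u\<in>{x, y, z} - ?V. f u = 0)"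
    if v: "v \<in> ?V" for v
  proof -
    obtain i where i: "i \<in> {1..n}" and vi: "v = VA i \<or> v = VB i"
      using v by (auto simp: ladder_vertices_def)
    define c where "c = (\<lambda>j. ((0, 0) # xs @ [(0, 0)]) ! j)"
    have "column_ok (c (i - 1)) (c i) (c (i + 1))"
    proof -
      have "i - 1 + 2 < length ((0, 0) # xs @ [(0, 0)])" "i - 1 + 1 = i" "i - 1 + 2 = i + 1"
        using i n by auto
      then show ?thesis using columns_ok_nth[OF ok, of "i - 1"] by (metis c_def)
    qed
    moreover have "c j = (f (VA j), f (VB j))" for j
      by (simp add: c_def f_def labelling_def)
    ultimately have ok_i: "vertex_ok (f (VA i)) [f (VA (i - 1)), f (VA (i + 1)), f (VB i)]"
      "vertex_ok (f (VB i)) [f (VB (i - 1)), f (VB (i + 1)), f (VA i)]"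
      by auto
    \<comment> \<open>Candidates outside the ladder lie only in columns 0 and n + 1, where the
      padding is 0.\<close>
    have "i - 1 \<in> {1..n} \<or> i - 1 = 0" "i + 1 \<in> {1..n} \<or> i = n"
      using i by auto
    then have zero_i: "\<forall>u\<in>{VA (i - 1), VA (i + 1), VB i} - ?V. f u = 0"
      "\<forall>u\<in>{VB (i - 1), VB (i + 1), VA i} - ?V. f u = 0"
      using zero i by auto
    have "distinct [VA (i - 1), VA (i + 1), VB i]" "distinct [VB (i - 1), VB (i + 1), VA i]"
      by auto
    then show ?thesis
      using vi ok_i zero_i nbhd_ladder_VA[OF i] nbhd_ladder_VB[OF i] by metis
  qed
  note * = this
  show ?thesis
    unfolding plsrd_function_iff[OF finite_simple_graph_ladder]
  proof (intro conjI ballI)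
    fix v assume v: "v \<in> ?V"
    obtain x y z where xyz: "vertex_ok (f v) [f x, f y, f z]" "distinct [x, y, z]"
      "nbhd ?V ?E v = {x, y, z} \<inter> ?V" "\<forall>u\<in>{x, y, z} - ?V. f u = 0"
      using *[OF v] by (elim exE conjE)
    note facts = vertex_ok_neighbours[where f = f, OF xyz(1-3) bspec[OF xyz(4)]]
    show "f v \<in> {-1, 1, 2}" by (rule facts)
    show "f v = -1 \<longrightarrow> (\<exists>!u. u \<in> nbhd ?V ?E v \<and> f u = 2)" using facts(2) by blast
    show "f v = 2 \<longrightarrow> (\<forall>p\<in>nbhd ?V ?E v. \<forall>q\<in>nbhd ?V ?E v. f p = -1 \<longrightarrow> f q = -1 \<longrightarrow> p = q)"
      using facts(3) by blast
    show "f v + sum f (nbhd ?V ?E v) \<ge> 1" by (rule facts)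
  qed
qed

lemma plsrd_weight_labelling:
  assumes "length xs = n"
  shows "plsrd_weight (ladder_vertices n) (labelling ((0, 0) # xs @ [(0, 0)])) = weight xs"
proof -
  \<comment> \<open>The front padding shifts indices: column \<open>i\<close> of the ladder is entry
    \<open>i - 1\<close> of \<open>xs\<close>.\<close>
  have "plsrd_weight (ladder_vertices n) (labelling ((0, 0) # xs @ [(0, 0)]))
      = (\<Sum>i=1..n. fst (xs ! (i - 1)) + snd (xs ! (i - 1)))"
    unfolding plsrd_weight_def sum_ladder_vertices
    using assms by (intro sum.cong) (auto simp: labelling_def nth_append)
  also have "\<dots> = (\<Sum>i<n. fst (xs ! i) + snd (xs ! i))"
    by (rule sum.reindex_bij_witness[of _ "\<lambda>i. i + 1" "\<lambda>i. i - 1"]) auto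
  also have "\<dots> = weight xs"
    using assms by (simp add: weight_def sum_list_sum_nth atLeast0LessThan)
  finally show ?thesis .
qed

text \<open>
  The condition with prefix \<open>(1, 2), (-1, 2)\<close> is what allows prepending a block: the reflected
  block ends in these two columns.
\<close>

lemma ex_columns:
  assumes "2 \<le> n"
  shows "\<exists>xs. length xs = n \<and> columns_ok ((0, 0) # xs @ [(0, 0)]) \<and>
     columns_ok ((1, 2) # (-1, 2) # xs @ [(0, 0)]) \<and>
     6 * int n \<le> 5 * weight xs \<and> 5 * weight xs \<le> 6 * int n + 4"
  using assms
proof (induction n rule: less_induct)
  case (less n)
  note defs = vertex_ok_def weight_def
  \<comment> \<open>The induction goes in steps of five, so five consecutive base cases are needed;
    their weights are 3, 4, 5, 6, 8.\<close>
  consider "n = 2" | "n = 3" | "n = 4" | "n = 5" | "n = 6" | "7 \<le> n"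
    using less.prems by linarith
  then show ?case
  proof cases
    case 1
    show ?thesis
      by (rule exI[of _ "[(-1, 1), (2, 1)]"]) (simp add: defs 1)
  next
    case 2
    show ?thesis
      by (rule exI[of _ "[(-1, 1), (2, 1), (2, -1)]"]) (simp add: defs 2)
  next
    case 3
    show ?thesis
      by (rule exI[of _ "[(-1, 2), (1, 2), (-1, -1), (2, 1)]"]) (simp add: defs 3)
  next
    case 4
    show ?thesis
      by (rule exI[of _ "[(-1, 2), (1, 2), (-1, -1), (2, 1), (2, -1)]"]) (simp add: defs 4)
  next
    case 5
    show ?thesis
      by (rule exI[of _ "[(-1, 1), (2, 1), (1, 2), (-1, -1), (2, 1), (2, -1)]"])
        (simp add: defs 5)
  next
    case 6
    then have "n - 5 < n" "2 \<le> n - 5" by linarith+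
    then obtain xs where xs: "length xs = n - 5" "columns_ok ((1, 2) # (-1, 2) # xs @ [(0, 0)])"
      and w: "6 * int (n - 5) \<le> 5 * weight xs" "5 * weight xs \<le> 6 * int (n - 5) + 4"
      using less.IH[of "n - 5"] by blast
    let ?ys = "map prod.swap xs"
    let ?zs = "[(-1, 2), (1, 2), (-1, -1), (2, 1), (2, -1)] @ ?ys"
    \<comment> \<open>Reflecting the induction hypothesis turns its prefix into the last two columns
      of the block. This settles the last block column and all of \<open>?ys\<close>.\<close>
    have ok: "columns_ok ((2, 1) # (2, -1) # ?ys @ [(0, 0)])"
      using xs(2) columns_ok_swap[of "(1, 2) # (-1, 2) # xs @ [(0, 0)]"] by simp
    \<comment> \<open>Five columns of total weight 6 raise \<open>6 * n\<close> and
      \<open>5 * weight\<close> by 30 each, so both bounds persist.\<close>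
    have "weight ?zs = 6 + weight xs"
      using weight_swap[of xs] by (simp add: weight_def)
    then have "6 * int n \<le> 5 * weight ?zs" "5 * weight ?zs \<le> 6 * int n + 4"
      using w 6 by simp_all
    moreover have "length ?zs = n" using xs(1) 6 by simp
    \<comment> \<open>Beyond \<open>ok\<close>, only tests on explicit columns remain: the first
      four of the block and, in the second claim, the prefix column \<open>(-1, 2)\<close>.\<close>
    moreover have "columns_ok ((0, 0) # ?zs @ [(0, 0)])"
      "columns_ok ((1, 2) # (-1, 2) # ?zs @ [(0, 0)])"
      using ok by (simp_all add: vertex_ok_def)
    ultimately show ?thesis by blast
  qed
qed

section \<open>Matching the two bounds\<close>

theorem theorem3:
  fixes n :: nat
  assumes "n \<ge> 2"
  shows "plsrd_number (ladder_vertices n) (ladder_edges n) = \<lceil>6 * real n / 5\<rceil>"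
proof -
  let ?V = "ladder_vertices n" and ?E = "ladder_edges n"
  obtain xs where xs: "length xs = n" "columns_ok ((0, 0) # xs @ [(0, 0)])"
    and w: "6 * int n \<le> 5 * weight xs" "5 * weight xs \<le> 6 * int n + 4"
    using ex_columns[OF assms] by blast
  \<comment> \<open>The slack 4 is less than 5, so \<open>weight xs - 1\<close> lies strictly below
    6 n / 5.\<close>
  have ceil: "\<lceil>6 * real n / 5\<rceil> = weight xs"
    using w by (intro ceiling_unique) linarith+
  have "Min {plsrd_weight ?V f |f. plsrd_function ?V ?E f} = weight xs"
  proof (rule Min_eqI)
    show "finite {plsrd_weight ?V f |f. plsrd_function ?V ?E f}"
      by (rule plsrd_weights_finite[OF finite_simple_graph_ladder])
    show "weight xs \<in> {plsrd_weight ?V f |f. plsrd_function ?V ?E f}"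
      using plsrd_function_labelling[OF xs(2,1)] plsrd_weight_labelling[OF xs(1)] by force
    fix y assume "y \<in> {plsrd_weight ?V f |f. plsrd_function ?V ?E f}"
    then obtain f where "plsrd_function ?V ?E f" "y = plsrd_weight ?V f" by blast
    then have "6 * int n \<le> 5 * y"
      using plsrd_weight_ge[OF finite_simple_graph_ladder _ card_nbhd_ladder[OF assms]]
      by (fastforce simp: card_ladder_vertices)
    \<comment> \<open>Here \<open>5 * weight xs \<le> 5 * y + 4\<close>, and both weights are
      integers.\<close>
    then show "weight xs \<le> y" using w by linarith
  qed
  then show ?thesis by (simp add: plsrd_number_def ceil)
qed

end
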